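(* Let $\mathbb{F}_q$ be the finite field of $q$ elements. Then there are group isomorphisms $$\mathcal{P}_{\mathbb{F}_q}(\mathbb{F}_q[\alpha])\cong \mathcal{P}(\mathbb{F}_q)\ltimes_\theta \mathcal{F}(\mathbb{F}_q)^\times\cong \mathcal{P}(\mathbb{F}_q)\ltimes_\theta \mathrm{Stab}_\alpha(\mathbb{F}_q).$$
   Context: For a commutative ring $A$ and $f\in A[x]$, $[f]_A\colon A\to A$ denotes the function $a\mapsto f(a)$; functions of this form are the polynomial functions on $A$. For $R$ a finite commutative ring with $1\ne 0$: $\mathcal{F}(R)$ is the set of polynomial functions on $R$, a commutative ring under pointwise operations; $\mathcal{F}(R)^\times$ is its group of units (under pointwise multiplication $\cdot$), which consists exactly of the polynomial functions $F$ with $F(r)\in R^\times$ for all $r\in R$. $\mathcal{P}(R)$ is the group, under composition, of bijective polynomial functions on $R$. $R[\alpha]=\{a+b\alpha: a,b\in R\}$ with $\alpha^2=0$ is the ring $R[x]/(x^2)$ of dual numbers over $R$. $\mathcal{P}_R(R[\alpha])$ is the group, under composition, of all bijections of $R[\alpha]$ of the form $[f]_{R[\alpha]}$ with $f\in R[x]$. $\mathrm{Stab}_\alpha(R)$ is the group, under composition, of all bijective polynomial functions $F$ on $R[\alpha]$ (induced by polynomials in $R[\alpha][x]$) such that $F(r)=r$ for every $r\in R$; every such $F$ is induced by some polynomial $x+f(x)$ with $f\in R[x]$ null on $R$ (i.e. $f(r)=0$ for all $r\in R$). For $G\in\mathcal{P}(R)$ let $\theta_G$ be the automorphism $F\mapsto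 F\circ G$ of $\mathcal{F}(R)^\times$. The group $\mathcal{P}(R)\ltimes_\theta\mathcal{F}(R)^\times$ is the set of pairs $(G,F)$ with $G\in\mathcal{P}(R)$, $F\in\mathcal{F}(R)^\times$, with multiplication $(G_1,F_1)(G_2,F_2)=\big(G_1\circ G_2,\ (F_1\circ G_2)\cdot F_2\big)$. For $R=\mathbb{F}_q$, the map $\phi\colon \mathrm{Stab}_\alpha(\mathbb{F}_q)\to\mathcal{F}(\mathbb{F}_q)^\times$ sending the function induced by $x+f(x)$, with $f\in\mathbb{F}_q[x]$ null on $\mathbb{F}_q$, to $[1+f']_{\mathbb{F}_q}$ (where $f'$ is the formal derivative) is a well-defined group isomorphism, and $\mathcal{P}(\mathbb{F}_q)\ltimes_\theta\mathrm{Stab}_\alpha(\mathbb{F}_q)$ denotes the semidirect product with the action transported along $\phi$: pairs $(G,S)$ with multiplication $(G_1,S_1)(G_2,S_2)=\big(G_1\circ G_2,\ \phi^{-1}(\phi(S_1)\circ G_2)\circ S_2\big)$. *)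

theory Defs
  imports "HOL-Algebra.Ring" "HOL-Computational_Algebra.Polynomial"
begin

text \<open>
  The ring of dual numbers over \<open>R\<close>: \<open>Dual a b\<close> stands for \<open>a + b\<alpha>\<close>, where \<open>\<alpha>\<^sup>2 = 0\<close>.
\<close>

datatype 'a dual = Dual (dual_re: 'a) (dual_im: 'a)

instantiation dual :: (comm_ring_1) comm_ring_1
begin

definition zero_dual :: "'a dual" where
  "zero_dual = Dual 0 0"

definition one_dual :: "'a dual" where
  "one_dual = Dual 1 0"

definition plus_dual :: "'a dual \<Rightarrow> 'a dual \<Rightarrow> 'a dual" where
  "plus_dual x y = Dual (dual_re x + dual_re y) (dual_im x + dual_im y)"

definition minus_dual :: "'a dual \<Rightarrow> 'a dual \<Rightarrow> 'a dual" where
  "minus_dual x y = Dual (dual_re x - dual_re y) (dual_im x - dual_im y)"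

definition uminus_dual :: "'a dual \<Rightarrow> 'a dual" where
  "uminus_dual x = Dual (- dual_re x) (- dual_im x)"

definition times_dual :: "'a dual \<Rightarrow> 'a dual \<Rightarrow> 'a dual" where
  "times_dual x y =
     Dual (dual_re x * dual_re y) (dual_re x * dual_im y + dual_im x * dual_re y)"

instance
  by standard
    (auto simp: zero_dual_def one_dual_def plus_dual_def minus_dual_def uminus_dual_def
      times_dual_def algebra_simps)

end

definition dual_alpha :: "'a::comm_ring_1 dual" where
  "dual_alpha = Dual 0 1"

definition dual_const :: "'a::comm_ring_1 \<Rightarrow> 'a dual" where
  "dual_const a = Dual a 0"

lemma dual_alpha_square: "dual_alpha * dual_alpha = (0 :: 'a::comm_ring_1 dual)"
  by (simp add: dual_alpha_def times_dual_def zero_dual_def)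

lemma Dual_eq: "Dual a b = dual_const a + dual_const b * dual_alpha"
  by (simp add: dual_alpha_def dual_const_def plus_dual_def times_dual_def)

text \<open>
  The function \<open>[f]\<^sub>A\<close> is \<open>poly f\<close>.  For \<open>f \<in> R[x]\<close> the function that \<open>f\<close> induces on the dual
  numbers is obtained by first reading the coefficients of \<open>f\<close> as dual numbers.
\<close>

definition dual_poly_fun :: "'a::comm_ring_1 poly \<Rightarrow> 'a dual \<Rightarrow> 'a dual" where
  "dual_poly_fun f = poly (map_poly dual_const f)"

definition poly_fun_ring :: "('a::comm_ring_1 \<Rightarrow> 'a) ring" where
  "poly_fun_ring =
     \<lparr>carrier = range poly,
      Group.monoid.mult = (\<lambda>F G r. F r * G r),
      one = (\<lambda>_. 1),
      zero = (\<lambda>_. 0),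
      add = (\<lambda>F G r. F r + G r)\<rparr>"

abbreviation poly_fun_units :: "('a::comm_ring_1 \<Rightarrow> 'a) monoid" where
  "poly_fun_units \<equiv> units_of poly_fun_ring"

definition perm_group :: "('a::comm_ring_1 \<Rightarrow> 'a) monoid" where
  "perm_group =
     \<lparr>carrier = {F \<in> range poly. bij F}, Group.monoid.mult = (\<circ>), one = id\<rparr>"

definition dual_perm_group :: "('a::comm_ring_1 dual \<Rightarrow> 'a dual) monoid" where
  "dual_perm_group =
     \<lparr>carrier = {F \<in> range dual_poly_fun. bij F}, Group.monoid.mult = (\<circ>), one = id\<rparr>"

definition stab_group :: "('a::comm_ring_1 dual \<Rightarrow> 'a dual) monoid" where
  "stab_group =
     perm_group\<lparr>carrier :=
       {F \<in> carrier perm_group. \<forall>r. F (dual_const r) = dual_const r}\<rparr>"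

text \<open>
  The semidirect product for a right action \<open>act\<close> of \<open>P\<close> on \<open>H\<close>.
\<close>

definition semidirect ::
  "('g, 'm) monoid_scheme \<Rightarrow> ('g \<Rightarrow> 'h \<Rightarrow> 'h) \<Rightarrow> ('h, 'n) monoid_scheme \<Rightarrow> ('g \<times> 'h) monoid"
where
  "semidirect P act H =
     \<lparr>carrier = carrier P \<times> carrier H,
      Group.monoid.mult =
        (\<lambda>(g1, h1) (g2, h2). (g1 \<otimes>\<^bsub>P\<^esub> g2, act g2 h1 \<otimes>\<^bsub>H\<^esub> h2)),
      one = (\<one>\<^bsub>P\<^esub>, \<one>\<^bsub>H\<^esub>)\<rparr>"

definition theta :: "('a \<Rightarrow> 'a) \<Rightarrow> ('a \<Rightarrow> 'a) \<Rightarrow> ('a \<Rightarrow> 'a)" where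
  "theta G F = F \<circ> G"

definition null_poly :: "'a::comm_ring_1 poly \<Rightarrow> bool" where
  "null_poly f \<longleftrightarrow> (\<forall>r. poly f r = 0)"

text \<open>
  The map \<open>\<phi>\<close> sends the function induced by \<open>x + f\<close>, with \<open>f\<close> null, to \<open>[1 + f']\<close>.  The lemma
  \<open>stab_phi_eq\<close> below shows that this does not depend on the choice of \<open>f\<close>.
\<close>

definition stab_phi :: "('a::{comm_ring_1, semiring_no_zero_divisors} dual \<Rightarrow> 'a dual) \<Rightarrow> ('a \<Rightarrow> 'a)" where
  "stab_phi S =
     (THE u. \<exists>f. null_poly f \<and> S = dual_poly_fun ([:0, 1:] + f) \<and> u = poly (1 + pderiv f))"

definition stab_theta ::
  "('a::{comm_ring_1, semiring_no_zero_divisors} \<Rightarrow> 'a) \<Rightarrow> ('a dual \<Rightarrow> 'a dual) \<Rightarrow> ('a dual \<Rightarrow> 'a dual)"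
where
  "stab_theta G S = inv_into (carrier stab_group) stab_phi (theta G (stab_phi S))"

lemma dual_poly_fun_Dual:
  fixes f :: "'a::{comm_ring_1, semiring_no_zero_divisors} poly"
  shows "dual_poly_fun f (Dual a b) = Dual (poly f a) (b * poly (pderiv f) a)"
proof (induction f)
  case 0
  then show ?case by (simp add: dual_poly_fun_def zero_dual_def)
next
  case (pCons c f)
  have "map_poly dual_const (pCons c f) = pCons (dual_const c) (map_poly dual_const f)"
    by (rule map_poly_pCons) (simp add: dual_const_def zero_dual_def)
  then show ?case
    using pCons.IH
    by (simp add: dual_poly_fun_def dual_const_def plus_dual_def times_dual_def pderiv_pCons
        algebra_simps)
qed

lemma stab_phi_eq:
  fixes f :: "'a::{comm_ring_1, semiring_no_zero_divisors} poly"
  assumes "null_poly f"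
  shows "stab_phi (dual_poly_fun ([:0, 1:] + f)) = poly (1 + pderiv f)"
  unfolding stab_phi_def
proof (rule the_equality)
  fix u
  assume "\<exists>g. null_poly g \<and> dual_poly_fun ([:0, 1:] + f) = dual_poly_fun ([:0, 1:] + g)
    \<and> u = poly (1 + pderiv g)"
  then obtain g where eq: "dual_poly_fun ([:0, 1:] + f) = dual_poly_fun ([:0, 1:] + g)"
    and u: "u = poly (1 + pderiv g)"
    by blast
  show "u = poly (1 + pderiv f)"
  proof
    fix a
    show "u a = poly (1 + pderiv f) a"
      using fun_cong[OF eq, of "Dual a 1"]
      by (simp add: u dual_poly_fun_Dual pderiv_add pderiv_pCons)
  qed
qed (use assms in blast)

end

theory Submission
  imports Defs
begin

text \<open>
  Over a finite field the value function and the derivative function of a polynomial can be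
  prescribed independently.  Hence the permutations of the dual numbers induced by polynomials over
  the field are exactly the maps \<open>a + b\<alpha> \<mapsto> G(a) + b F(a) \<alpha>\<close> with \<open>G\<close> bijective and \<open>F\<close> nowhere
  zero, and composing two of these maps is the multiplication of the semidirect product.  The
  stabilizer consists of the maps with \<open>G = id\<close>, and on it \<open>\<phi>\<close> just reads off \<open>F\<close>.
\<close>

subsection \<open>Interpolation over a finite field\<close>

text \<open>Lagrange interpolation with all field elements as nodes: \<open>M c\<close> vanishes at
  every point except \<open>c\<close>, so dividing by its value at \<open>c\<close> gives the
  indicator function of \<open>c\<close>.\<close>

lemma range_poly_finite_field: "range poly = (UNIV :: ('a::{field, finite} \<Rightarrow> 'a) set)"
proof (intro equalityI subsetI UNIV_I)
  fix F :: "'a \<Rightarrow> 'a"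
  define M where "M c = (\<Prod>d\<in>UNIV - {c}. [:-d, 1:])" for c :: 'a
  have M: "poly (M c) a = 0 \<longleftrightarrow> a \<noteq> c" for a c
    by (auto simp: M_def poly_prod)
  define p where "p = (\<Sum>c\<in>UNIV. smult (F c / poly (M c) c) (M c))"
  have "poly p a = F a" for a
  proof -
    have "poly p a = (\<Sum>c\<in>UNIV. if c = a then F c else 0)"
      unfolding p_def poly_sum by (intro sum.cong refl) (auto simp: M)
    then show ?thesis by simp
  qed
  then have "F = poly p" by auto
  then show "F \<in> range poly" by blast
qed

text \<open>An interpolant \<open>g\<close> of \<open>G\<close> is corrected by a multiple
  \<open>N * h\<close> of the null polynomial \<open>N\<close>. This leaves all values alone and
  changes the derivative function by that of \<open>pderiv N * h\<close>. As \<open>N\<close> has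
  only simple roots, its derivative vanishes nowhere, so \<open>h\<close> can be interpolated to
  produce any prescribed \<open>F\<close>.\<close>

lemma exists_poly_with_pderiv:
  fixes G F :: "'a::{field, finite} \<Rightarrow> 'a"
  obtains f where "poly f = G" "poly (pderiv f) = F"
proof -
  define N :: "'a poly" where "N = (\<Prod>d\<in>UNIV. [:-d, 1:])"
  have N: "poly N a = 0" for a
    by (auto simp: N_def poly_prod)
  have N': "poly (pderiv N) a \<noteq> 0" for a
  proof -
    define M where "M = (\<Prod>d\<in>UNIV - {a}. [:-d, 1:])"
    \<comment> \<open>Split off the simple root \<open>a\<close>: by the product rule the derivative
      of \<open>N\<close> at \<open>a\<close> is the value of the cofactor \<open>M\<close>, which
      has no root there.\<close>
    have "N = [:-a, 1:] * M"
      unfolding N_def M_def by (subst prod.remove[of UNIV a]) auto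
    then have "poly (pderiv N) a = poly M a"
      by (simp add: pderiv_mult pderiv_pCons del: mult_pCons_left)
    also have "\<dots> \<noteq> 0"
      by (auto simp: M_def poly_prod)
    finally show ?thesis .
  qed
  obtain g where g: "poly g = G"
    using range_poly_finite_field by (metis UNIV_I imageE)
  obtain h where h: "poly h = (\<lambda>a. (F a - poly (pderiv g) a) / poly (pderiv N) a)"
    using range_poly_finite_field by (metis UNIV_I imageE)
  show thesis
  proof
    show "poly (g + N * h) = G"
      by (rule ext) (simp add: N g)
    show "poly (pderiv (g + N * h)) = F"
      by (rule ext) (simp add: pderiv_add pderiv_mult N N' h)
  qed
qed

subsection \<open>Polynomial permutations of the dual numbers\<close>

text \<open>The first-order Taylor formula with the value function and the derivative function
  replaced by arbitrary functions, so that composition and bijectivity can be studied without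
  polynomials.\<close>

definition dual_map :: "('a \<Rightarrow> 'a) \<Rightarrow> ('a \<Rightarrow> 'a) \<Rightarrow> 'a dual \<Rightarrow> 'a::comm_ring_1 dual" where
  "dual_map G F x = Dual (G (dual_re x)) (dual_im x * F (dual_re x))"

lemma dual_map_inject: "dual_map G F = dual_map G' F' \<longleftrightarrow> G = G' \<and> F = F'"
proof
  assume *: "dual_map G F = dual_map G' F'"
  \<comment> \<open>The value at a + \<alpha> has \<open>G a\<close> and \<open>F a\<close> as its
    two coordinates.\<close>
  have "G a = G' a \<and> F a = F' a" for a
    using fun_cong[OF *, of "Dual a 1"] by (simp add: dual_map_def)
  then show "G = G' \<and> F = F'" by auto
qed simp

text \<open>The chain rule in pointwise form; its second component is the twisted product of the
  semidirect product.\<close>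

lemma dual_map_comp:
  "dual_map G F \<circ> dual_map G' F' = dual_map (G \<circ> G') (\<lambda>r. F (G' r) * F' r)"
  by (auto simp: dual_map_def mult_ac)

lemma dual_map_one: "dual_map id (\<lambda>_. 1) = id"
  by (auto simp: dual_map_def)

text \<open>The map sends the fibre of \<open>dual_re\<close> over \<open>a\<close> to the fibre
  over \<open>G a\<close> and acts there as multiplication by \<open>F a\<close>.\<close>

lemma bij_dual_map_iff:
  fixes G F :: "'a::field \<Rightarrow> 'a"
  shows "bij (dual_map G F) \<longleftrightarrow> bij G \<and> (\<forall>a. F a \<noteq> 0)"
proof
  assume *: "bij (dual_map G F)"
  have inj: "dual_map G F x = dual_map G F y \<Longrightarrow> x = y" for x y
    using * by (auto simp: bij_def inj_def)
  have "inj G"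
  proof (rule injI)
    fix a b
    assume "G a = G b"
    then show "a = b"
      using inj[of "Dual a 0" "Dual b 0"] by (simp add: dual_map_def)
  qed
  moreover have "surj G"
    unfolding surj_def
  proof
    fix a
    obtain x where "Dual a 0 = dual_map G F x"
      using * by (metis bij_def surjD)
    then show "\<exists>b. a = G b"
      by (auto simp: dual_map_def)
  qed
  \<comment> \<open>If \<open>F a\<close> were zero, a and a + \<alpha> would have the same
    image.\<close>
  moreover have "F a \<noteq> 0" for a
    using inj[of "Dual a 0" "Dual a 1"] by (auto simp: dual_map_def)
  ultimately show "bij G \<and> (\<forall>a. F a \<noteq> 0)"
    by (auto simp: bij_def)
next
  assume *: "bij G \<and> (\<forall>a. F a \<noteq> 0)"
  show "bij (dual_map G F)"
  proof (rule bijI)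
    show "inj (dual_map G F)"
    proof (rule injI)
      fix x y
      assume eq: "dual_map G F x = dual_map G F y"
      then have "dual_re x = dual_re y"
        using * by (auto simp: dual_map_def bij_def dest: injD)
      with eq * show "x = y"
        by (auto simp: dual_map_def intro: dual.expand)
    qed
    show "surj (dual_map G F)"
      unfolding surj_def
    proof
      fix y
      obtain a where a: "G a = dual_re y"
        using * by (metis bij_def surjD)
      show "\<exists>x. y = dual_map G F x"
        by (rule exI[of _ "Dual a (dual_im y / F a)"]) (use * a in \<open>simp add: dual_map_def\<close>)
    qed
  qed
qed

lemma dual_poly_fun_eq_dual_map:
  fixes f :: "'a::{comm_ring_1, semiring_no_zero_divisors} poly"
  shows "dual_poly_fun f = dual_map (poly f) (poly (pderiv f))"
proof
  fix x
  show "dual_poly_fun f x = dual_map (poly f) (poly (pderiv f)) x"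
    by (cases x) (simp add: dual_poly_fun_Dual dual_map_def)
qed

lemma range_dual_poly_fun:
  "range dual_poly_fun = (range (\<lambda>(G, F). dual_map G F) :: ('a::{field, finite} dual \<Rightarrow> 'a dual) set)"
proof (intro equalityI subsetI)
  fix S :: "'a dual \<Rightarrow> 'a dual"
  assume "S \<in> range (\<lambda>(G, F). dual_map G F)"
  then obtain G F where S: "S = dual_map G F" by auto
  obtain f where "poly f = G" "poly (pderiv f) = F"
    by (rule exists_poly_with_pderiv)
  then have "S = dual_poly_fun f"
    by (simp add: S dual_poly_fun_eq_dual_map)
  then show "S \<in> range dual_poly_fun" by blast
qed (auto simp: dual_poly_fun_eq_dual_map)

lemma carrier_dual_perm_group:
  "carrier (dual_perm_group :: ('a::{field, finite} dual \<Rightarrow> _) monoid) =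
     {dual_map G F | G F. bij G \<and> (\<forall>a. F a \<noteq> 0)}"
  unfolding dual_perm_group_def range_dual_poly_fun
  by (auto simp: bij_dual_map_iff dual_map_inject)

section \<open>The stabilizer of the constants and the map \<open>stab_phi\<close>\<close>

text \<open>Since \<alpha> squares to zero, the real part of \<open>p\<close> contributes its
  first-order Taylor expansion, while the \<alpha>-part contributes only its value at
  \<open>a\<close>.\<close>

lemma poly_dual:
  fixes p :: "'a::{comm_ring_1, semiring_no_zero_divisors} dual poly"
  shows "poly p (Dual a b) =
    Dual (poly (map_poly dual_re p) a)
      (b * poly (pderiv (map_poly dual_re p)) a + poly (map_poly dual_im p) a)"
proof (induction p)
  case 0
  then show ?case by (simp add: zero_dual_def)
next
  case (pCons c p)
  then show ?case
    by (simp add: map_poly_pCons zero_dual_def plus_dual_def times_dual_def pderiv_pCons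
        algebra_simps)
qed

text \<open>Polynomials with dual coefficients yield nothing beyond those over the field: fixing the
  constants forces the real part to induce the identity and the \<alpha>-part to induce zero, so
  only the derivative of the real part remains visible.\<close>

lemma carrier_stab_group:
  "carrier (stab_group :: ('a::{field, finite} dual \<Rightarrow> _) monoid) =
     {dual_map id F | F. \<forall>a. F a \<noteq> 0}"
proof (intro equalityI subsetI)
  fix S :: "'a dual \<Rightarrow> 'a dual"
  assume "S \<in> carrier stab_group"
  then obtain p where p: "S = poly p" and bij: "bij S"
    and fix_const: "S (dual_const r) = dual_const r" for r
    by (auto simp: stab_group_def perm_group_def)
  define F where "F = poly (pderiv (map_poly dual_re p))"
  have "S x = dual_map id F x" for x
    using fix_const[of "dual_re x"]
    by (cases x) (simp add: p dual_const_def poly_dual dual_map_def F_def)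
  then have "S = dual_map id F" by auto
  with bij show "S \<in> {dual_map id F | F. \<forall>a. F a \<noteq> 0}"
    by (auto simp: bij_dual_map_iff)
next
  fix S :: "'a dual \<Rightarrow> 'a dual"
  assume "S \<in> {dual_map id F | F. \<forall>a. F a \<noteq> 0}"
  then obtain F where S: "S = dual_map id F" and F: "\<forall>a. F a \<noteq> 0" by auto
  have "S \<in> range dual_poly_fun"
    unfolding range_dual_poly_fun S by auto
  then have "S \<in> range poly"
    by (auto simp: dual_poly_fun_def)
  moreover have "bij S"
    using F by (simp add: S bij_dual_map_iff)
  ultimately show "S \<in> carrier stab_group"
    by (auto simp: stab_group_def perm_group_def S dual_map_def dual_const_def)
qed

lemma stab_phi_dual_map:
  fixes F :: "'a::{field, finite} \<Rightarrow> 'a"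
  shows "stab_phi (dual_map id F) = F"
proof -
  \<comment> \<open>A null \<open>f\<close> with derivative function \<open>F - 1\<close> makes x +
    f induce \<open>dual_map id F\<close>.\<close>
  obtain f where f: "poly f = (\<lambda>_. 0)" "poly (pderiv f) = (\<lambda>a. F a - 1)"
    by (rule exists_poly_with_pderiv)
  have "dual_map id F = dual_poly_fun ([:0, 1:] + f)"
    unfolding dual_poly_fun_eq_dual_map dual_map_inject
    by (auto simp: f pderiv_add pderiv_pCons)
  moreover have "null_poly f"
    by (simp add: null_poly_def f)
  moreover have "poly (1 + pderiv f) = F"
    by (rule ext) (simp add: f)
  ultimately show ?thesis
    by (simp add: stab_phi_eq)
qed

text \<open>On the stabilizer \<open>stab_phi\<close> is injective, so \<open>inv_into\<close>
  returns the genuine preimage; \<open>F \<circ> G\<close> has one because it is again nowhere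
  zero.\<close>

lemma stab_theta_dual_map:
  fixes F :: "'a::{field, finite} \<Rightarrow> 'a"
  assumes "\<forall>a. F a \<noteq> 0"
  shows "stab_theta G (dual_map id F) = dual_map id (F \<circ> G)"
proof -
  have "inj_on stab_phi (carrier (stab_group :: ('a dual \<Rightarrow> _) monoid))"
    by (rule inj_onI) (auto simp: carrier_stab_group stab_phi_dual_map)
  moreover have "dual_map id (F \<circ> G) \<in> carrier stab_group"
    using assms by (auto simp: carrier_stab_group)
  ultimately have
    "inv_into (carrier stab_group) stab_phi (stab_phi (dual_map id (F \<circ> G))) = dual_map id (F \<circ> G)"
    by (rule inv_into_f_f)
  then show ?thesis
    by (simp add: stab_theta_def stab_phi_dual_map theta_def)
qed

subsection \<open>The semidirect product\<close>

lemma group_semidirect: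
  assumes "group P" and "group H"
    and hom: "\<And>g. g \<in> carrier P \<Longrightarrow> act g \<in> hom H H"
    and act_one: "\<And>h. h \<in> carrier H \<Longrightarrow> act \<one>\<^bsub>P\<^esub> h = h"
    and act_mult: "\<And>g g' h. \<lbrakk>g \<in> carrier P; g' \<in> carrier P; h \<in> carrier H\<rbrakk>
      \<Longrightarrow> act (g \<otimes>\<^bsub>P\<^esub> g') h = act g' (act g h)"
  shows "group (semidirect P act H)"
proof -
  interpret P: group P by fact
  interpret H: group H by fact
  have closed: "act g h \<in> carrier H" if "g \<in> carrier P" "h \<in> carrier H" for g h
    using hom that by (auto simp: hom_def)
  have mult: "act g (h \<otimes>\<^bsub>H\<^esub> h') = act g h \<otimes>\<^bsub>H\<^esub> act g h'"
    if "g \<in> carrier P" "h \<in> carrier H" "h' \<in> carrier H" for g h h'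
    using hom that by (auto simp: hom_def)
  have one: "act g \<one>\<^bsub>H\<^esub> = \<one>\<^bsub>H\<^esub>" if "g \<in> carrier P" for g
    using hom_one[OF hom] that assms(2) by blast
  show ?thesis
  proof (rule groupI)
    fix x
    assume "x \<in> carrier (semidirect P act H)"
    then obtain g h where x: "x = (g, h)" "g \<in> carrier P" "h \<in> carrier H"
      by (auto simp: semidirect_def)
    \<comment> \<open>Solving y x = 1 requires \<open>act g\<close> of the second coordinate to be
      the inverse of \<open>h\<close>; the right-action law then dictates applying the action of the
      inverse of \<open>g\<close>.\<close>
    let ?y = "(inv\<^bsub>P\<^esub> g, act (inv\<^bsub>P\<^esub> g) (inv\<^bsub>H\<^esub> h))"
    have "act g (act (inv\<^bsub>P\<^esub> g) (inv\<^bsub>H\<^esub> h)) = inv\<^bsub>H\<^esub> h"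
      using x by (simp flip: act_mult add: act_one)
    then show "\<exists>y\<in>carrier (semidirect P act H).
        y \<otimes>\<^bsub>semidirect P act H\<^esub> x = \<one>\<^bsub>semidirect P act H\<^esub>"
      using x by (intro bexI[of _ ?y]) (auto simp: semidirect_def closed)
  qed (auto simp: semidirect_def closed mult one act_one act_mult P.m_assoc H.m_assoc)
qed

section \<open>The two factors over a finite field and their semidirect product\<close>

lemma group_perm_group: "group (perm_group :: ('a::{field, finite} \<Rightarrow> 'a) monoid)"
proof (rule groupI)
  fix F :: "'a \<Rightarrow> 'a"
  assume "F \<in> carrier perm_group"
  then show "\<exists>G\<in>carrier perm_group. G \<otimes>\<^bsub>perm_group\<^esub> F = \<one>\<^bsub>perm_group\<^esub>"
    \<comment> \<open>The inverse permutation is a polynomial function because every function is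
      one.\<close>
    by (intro bexI[of _ "inv_into UNIV F"])
      (auto simp: perm_group_def range_poly_finite_field bij_imp_bij_inv bij_is_inj)
qed (auto simp: perm_group_def range_poly_finite_field bij_comp comp_assoc)

text \<open>By interpolation the pointwise reciprocal of a nowhere zero function is again a
  polynomial function.\<close>

lemma carrier_poly_fun_units:
  "carrier (poly_fun_units :: ('a::{field, finite} \<Rightarrow> 'a) monoid) = {F. \<forall>a. F a \<noteq> 0}"
proof (intro equalityI subsetI)
  fix F :: "'a \<Rightarrow> 'a"
  assume "F \<in> carrier poly_fun_units"
  then obtain G where "(\<lambda>r. G r * F r) = (\<lambda>_. 1)"
    by (auto simp: units_of_def Units_def poly_fun_ring_def)
  then have "F a \<noteq> 0" for a
    by (auto dest: fun_cong[of _ _ a])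
  then show "F \<in> {F. \<forall>a. F a \<noteq> 0}"
    by simp
next
  fix F :: "'a \<Rightarrow> 'a"
  assume "F \<in> {F. \<forall>a. F a \<noteq> 0}"
  then have "(\<lambda>r. inverse (F r) * F r) = (\<lambda>_. 1) \<and> (\<lambda>r. F r * inverse (F r)) = (\<lambda>_. 1)"
    by auto
  then show "F \<in> carrier poly_fun_units"
    unfolding units_of_def Units_def poly_fun_ring_def range_poly_finite_field
    by (auto intro!: exI[of _ "\<lambda>r. inverse (F r)"])
qed

lemma group_poly_fun_units: "group (poly_fun_units :: ('a::{field, finite} \<Rightarrow> 'a) monoid)"
proof (rule monoid.units_group)
  show "monoid (poly_fun_ring :: ('a \<Rightarrow> 'a) ring)"
    by (rule monoidI) (auto simp: poly_fun_ring_def range_poly_finite_field mult.assoc)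
qed

text \<open>Precomposition respects pointwise products and reverses the order of composition, which
  is exactly the right-action law.\<close>

lemma group_semidirect_theta:
  "group (semidirect perm_group theta (poly_fun_units :: ('a::{field, finite} \<Rightarrow> 'a) monoid))"
proof (rule group_semidirect[OF group_perm_group group_poly_fun_units])
  show "theta G \<in> hom poly_fun_units poly_fun_units" for G :: "'a \<Rightarrow> 'a"
    by (rule homI)
      (simp_all only: carrier_poly_fun_units, auto simp: theta_def units_of_def poly_fun_ring_def)
qed (auto simp: theta_def perm_group_def)

subsection \<open>The isomorphisms\<close>

lemma carrier_semidirect_theta:
  "carrier (semidirect perm_group theta (poly_fun_units :: ('a::{field, finite} \<Rightarrow> 'a) monoid)) =
     {(G, F). bij G \<and> (\<forall>a. F a \<noteq> 0)}"
  by (auto simp: semidirect_def carrier_poly_fun_units)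
    (auto simp: perm_group_def range_poly_finite_field)

lemma mult_semidirect_theta:
  "(G, F) \<otimes>\<^bsub>semidirect perm_group theta poly_fun_units\<^esub> (G', F') =
     (G \<circ> G', \<lambda>r. F (G' r) * F' r)"
  by (simp add: semidirect_def perm_group_def theta_def units_of_def poly_fun_ring_def)

lemma one_semidirect_theta:
  "\<one>\<^bsub>semidirect perm_group theta poly_fun_units\<^esub> = (id, \<lambda>_. 1)"
  by (simp add: semidirect_def perm_group_def units_of_def poly_fun_ring_def)

lemma dual_map_iso:
  "(\<lambda>(G, F). dual_map G F) \<in>
     iso (semidirect perm_group theta poly_fun_units)
       (dual_perm_group :: ('a::{field, finite} dual \<Rightarrow> _) monoid)"
proof (rule isoI)
  have mult_dual_perm_group:
    "S \<otimes>\<^bsub>dual_perm_group\<^esub> T = S \<circ> T" for S T :: "'a dual \<Rightarrow> 'a dual"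
    by (simp add: dual_perm_group_def)
  show "(\<lambda>(G, F). dual_map G F) \<in>
      hom (semidirect perm_group theta poly_fun_units)
        (dual_perm_group :: ('a dual \<Rightarrow> _) monoid)"
    by (rule homI)
      (auto simp: carrier_semidirect_theta carrier_dual_perm_group mult_semidirect_theta
        mult_dual_perm_group dual_map_comp)
  show "bij_betw (\<lambda>(G, F). dual_map G F)
      (carrier (semidirect perm_group theta poly_fun_units))
      (carrier (dual_perm_group :: ('a dual \<Rightarrow> _) monoid))"
    by (auto simp: bij_betw_def inj_on_def carrier_semidirect_theta carrier_dual_perm_group
        dual_map_inject)
qed

lemma stab_iso:
  "(\<lambda>(G, F). (G, dual_map id F)) \<in>
     iso (semidirect perm_group theta poly_fun_units)
       (semidirect perm_group stab_theta (stab_group :: ('a::{field, finite} dual \<Rightarrow> _) monoid))"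
proof (rule isoI)
  have carrier: "carrier (semidirect perm_group stab_theta
      (stab_group :: ('a dual \<Rightarrow> _) monoid)) =
      {(G, dual_map id F) | G F. bij G \<and> (\<forall>a. F a \<noteq> 0)}"
    by (auto simp: semidirect_def carrier_stab_group)
      (auto simp: perm_group_def range_poly_finite_field)
  have mult: "(G, dual_map id F) \<otimes>\<^bsub>semidirect perm_group stab_theta stab_group\<^esub>
      (G', dual_map id F') = (G \<circ> G', dual_map id (\<lambda>r. F (G' r) * F' r))"
    if "\<forall>a. F a \<noteq> 0" for G G' F F' :: "'a \<Rightarrow> 'a"
    using that
    by (simp add: semidirect_def stab_theta_dual_map stab_group_def perm_group_def dual_map_comp)
  show "(\<lambda>(G, F). (G, dual_map id F)) \<in>
      hom (semidirect perm_group theta poly_fun_units)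
        (semidirect perm_group stab_theta (stab_group :: ('a dual \<Rightarrow> _) monoid))"
    by (rule homI) (auto simp: carrier_semidirect_theta carrier mult_semidirect_theta mult)
  show "bij_betw (\<lambda>(G, F). (G, dual_map id F))
      (carrier (semidirect perm_group theta poly_fun_units))
      (carrier (semidirect perm_group stab_theta (stab_group :: ('a dual \<Rightarrow> _) monoid)))"
    by (auto simp: bij_betw_def inj_on_def carrier_semidirect_theta carrier dual_map_inject)
qed

theorem theorem4p9:
  fixes PR :: "('a::{field, finite} dual \<Rightarrow> 'a dual) monoid"
    and PF :: "(('a \<Rightarrow> 'a) \<times> ('a \<Rightarrow> 'a)) monoid"
    and PS :: "(('a \<Rightarrow> 'a) \<times> ('a dual \<Rightarrow> 'a dual)) monoid"
  defines "PR \<equiv> dual_perm_group"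
    and "PF \<equiv> semidirect perm_group theta poly_fun_units"
    and "PS \<equiv> semidirect perm_group stab_theta stab_group"
  shows "group PR \<and> group PF \<and> group PS \<and> PR \<cong> PF \<and> PF \<cong> PS"
proof -
  have PF: "group PF"
    unfolding PF_def by (rule group_semidirect_theta)
  have iso_R: "(\<lambda>(G, F). dual_map G F) \<in> iso PF PR"
    unfolding PF_def PR_def by (rule dual_map_iso)
  have iso_S: "(\<lambda>(G, F). (G, dual_map id F)) \<in> iso PF PS"
    unfolding PF_def PS_def by (rule stab_iso)
  \<comment> \<open>Transport of the group structure along an isomorphism takes the image of the
    unit as the new unit, so this image must be matched with the declared one.\<close>
  have "PR\<lparr>one := (\<lambda>(G, F). dual_map G F) \<one>\<^bsub>PF\<^esub>\<rparr> = PR"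
    by (simp add: PF_def PR_def one_semidirect_theta dual_map_one dual_perm_group_def)
  then have PR: "group PR"
    using group.iso_imp_img_group[OF PF iso_R] by simp
  have "PS\<lparr>one := (\<lambda>(G, F). (G, dual_map id F)) \<one>\<^bsub>PF\<^esub>\<rparr> = PS"
    by (simp add: PF_def PS_def one_semidirect_theta dual_map_one)
      (simp add: semidirect_def stab_group_def perm_group_def)
  then have PS: "group PS"
    using group.iso_imp_img_group[OF PF iso_S] by simp
  show ?thesis
    using PF PR PS iso_R iso_S group.iso_sym[OF PF] by (auto simp: is_iso_def)
qed

end
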